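(* Let $r\ge 2$ be an integer, let $N_r$ be a Baker--Jin threshold for $r$ (as defined in the context), and let $q$ be a prime power with $r\mid (q-1)$ and $q\ge N_r$. Let $G_r$ be the unique subgroup of $\mathbb{F}_q^\times$ of index $r$ and let $K=\mathbb{F}_q/G_r$ be the Krasner quotient hyperfield. Then: (i) if $r$ is odd, then $(\mathrm{char}\,K,\ \mathrm{C\text{-}char}\,K)=(2,1)$; (ii) if $r$ is even and $q\equiv 1\pmod{2r}$, then $(\mathrm{char}\,K,\ \mathrm{C\text{-}char}\,K)=(2,1)$; (iii) if $r$ is even and $q\equiv r+1\pmod{2r}$, then $(\mathrm{char}\,K,\ \mathrm{C\text{-}char}\,K)=(3,1)$. In particular, for even $r$ the two stable classes $\mathbb{H}_r$ and $\mathbb{H}_r'$ are separated by characteristic, i.e. $\mathrm{char}\,\mathbb{H}_r\neq \mathrm{char}\,\mathbb{H}_r'$.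
   Context: Hyperfield: a tuple $(F,\boxplus,\cdot,0,1)$ where $(F\setminus\{0\},\cdot)$ is an abelian group with identity $1$, $(F,\boxplus,0)$ is a canonical hypergroup ($\boxplus$ is a commutative, associative multivalued operation with values in nonempty subsets of $F$, $x\boxplus 0=\{x\}$, every $x$ has a unique $-x$ with $0\in x\boxplus(-x)$, and $z\in x\boxplus y$ implies $y\in z\boxplus(-x)$), multiplication distributes over $\boxplus$, and $0$ is absorbing for multiplication. For a subset $A\subseteq F$ and $b\in F$, $A\boxplus b=\bigcup_{a\in A}a\boxplus b$. Write $F^\times=F\setminus\{0\}$. An isomorphism of hyperfields is a bijection preserving $0$, $1$, multiplication, and hyperaddition (as set-valued operation). Krasner quotient: let $q$ be a prime power, $r\mid(q-1)$, and $G_r$ the unique subgroup of $\mathbb{F}_q^\times$ of index $r$. The hyperfield $\mathbb{F}_q/G_r$ has underlying set $(\mathbb{F}_q^\times/G_r)\cup\{0\}$ (of cardinality $r+1$), the usual coset product as multiplication on nonzero elements (with $0$ absorbing), and hyperaddition $[x]\boxplus[y]=\{[x+yg] : g\in G_r\}$, where $[x]=xG_r$ and $[0]=0$; thus $0\in[x]\boxplus[y]$ exactly when $0\in xG_r+yG_r$. Characteristics: for a hyperfield $F$ put $1\times_F 1=\{1\}$ and $n\times_F 1=((n-1)\times_F 1)\boxplus 1$ for $n\ge 2$. Then $\mathrm{char}\,F=\min\{n\in\mathbb{N}: n\ge 1,\ 0\in n\times_F 1\}$ (or $\infty$ if no such $n$ exists) and $\mathrm{C\text{-}char}\,F=\min\{n\in\mathbb{N}: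 n\ge 1,\ 1\in (n+1)\times_F 1\}$ (or $\infty$ if no such $n$ exists). Stable models: $\mathbb{H}_r$ (for $r\ge 2$) is the hyperfield with $r+1$ elements whose multiplicative group is cyclic of order $r$, with $0$ neutral for $\boxplus$, $-x=x$ for all $x$, $x\boxplus x=\mathbb{H}_r$ for $x\ne 0$, and $x\boxplus y=\mathbb{H}_r^\times$ for distinct nonzero $x,y$. For even $r$, $\mathbb{H}_r'$ is the hyperfield with $r+1$ elements whose multiplicative group is cyclic of order $r$, with $g'$ its unique element of order $2$, with $0$ neutral for $\boxplus$, $-x=g'x$, $x\boxplus(g'x)=\mathbb{H}_r'$ for $x\neq 0$, and $x\boxplus y=(\mathbb{H}_r')^\times$ whenever $x,y\ne 0$ and $y\ne g'x$. Baker--Jin threshold: a positive integer $N_r$ such that for all prime powers $q\ge N_r$ with $r\mid(q-1)$: (1) if $r$ is odd, $\mathbb{F}_q/G_r\cong\mathbb{H}_r$; (2) if $r$ is even, $\mathbb{F}_q/G_r\cong \mathbb{H}_r$ when $q\equiv 1\pmod{2r}$ and $\mathbb{F}_q/G_r\cong\mathbb{H}_r'$ when $q\equiv r+1\pmod{2r}$. By a theorem of Baker and Jin such an $N_r$ exists for each $r\ge 2$; for example $N_r=r^4$ is one. *)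

theory Defs
  imports
    "HOL-Algebra.Multiplicative_Group"
    "HOL-Algebra.Elementary_Groups"
    "HOL-Number_Theory.Prime_Powers"
    "HOL-Number_Theory.Cong"
    "HOL-Library.Extended_Nat"
begin

no_notation (input) subset_mset (infix \<open><#\<close> 50)

section \<open>Hyperfields\<close>

record 'a hyperstructure = "'a monoid" +
  hzero :: 'a
  hadd :: "['a, 'a] \<Rightarrow> 'a set"  (infixl \<open>\<boxplus>\<index>\<close> 65)

definition hunits :: "('a, 'b) hyperstructure_scheme \<Rightarrow> 'a monoid" where
  "hunits F = \<lparr>carrier = carrier F - {hzero F}, monoid.mult = monoid.mult F, one = \<one>\<^bsub>F\<^esub>\<rparr>"

definition hneg :: "('a, 'b) hyperstructure_scheme \<Rightarrow> 'a \<Rightarrow> 'a" where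
  "hneg F x = (THE y. y \<in> carrier F \<and> hzero F \<in> x \<boxplus>\<^bsub>F\<^esub> y)"

definition hadd_set :: "('a, 'b) hyperstructure_scheme \<Rightarrow> 'a set \<Rightarrow> 'a \<Rightarrow> 'a set" where
  "hadd_set F A b = (\<Union>a\<in>A. a \<boxplus>\<^bsub>F\<^esub> b)"

locale canonical_hypergroup =
  fixes F :: "('a, 'b) hyperstructure_scheme" (structure)
  assumes hzero_closed: "hzero F \<in> carrier F"
    and hadd_closed: "\<lbrakk>x \<in> carrier F; y \<in> carrier F\<rbrakk> \<Longrightarrow> x \<boxplus> y \<subseteq> carrier F"
    and hadd_nonempty: "\<lbrakk>x \<in> carrier F; y \<in> carrier F\<rbrakk> \<Longrightarrow> x \<boxplus> y \<noteq> {}"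
    and hadd_commute: "\<lbrakk>x \<in> carrier F; y \<in> carrier F\<rbrakk> \<Longrightarrow> x \<boxplus> y = y \<boxplus> x"
    and hadd_assoc: "\<lbrakk>x \<in> carrier F; y \<in> carrier F; z \<in> carrier F\<rbrakk>
      \<Longrightarrow> hadd_set F (x \<boxplus> y) z = (\<Union>w \<in> y \<boxplus> z. x \<boxplus> w)"
    and hadd_hzero: "x \<in> carrier F \<Longrightarrow> x \<boxplus> hzero F = {x}"
    and hneg_unique: "x \<in> carrier F \<Longrightarrow> \<exists>!y. y \<in> carrier F \<and> hzero F \<in> x \<boxplus> y"
    and reversible: "\<lbrakk>x \<in> carrier F; y \<in> carrier F; z \<in> x \<boxplus> y\<rbrakk>
      \<Longrightarrow> y \<in> z \<boxplus> hneg F x"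

locale hyperfield = canonical_hypergroup +
  assumes hunits_group: "comm_group (hunits F)"
    and distrib_left: "\<lbrakk>x \<in> carrier F; y \<in> carrier F; z \<in> carrier F\<rbrakk>
      \<Longrightarrow> (\<lambda>w. x \<otimes> w) ` (y \<boxplus> z) = (x \<otimes> y) \<boxplus> (x \<otimes> z)"
    and distrib_right: "\<lbrakk>x \<in> carrier F; y \<in> carrier F; z \<in> carrier F\<rbrakk>
      \<Longrightarrow> (\<lambda>w. w \<otimes> x) ` (y \<boxplus> z) = (y \<otimes> x) \<boxplus> (z \<otimes> x)"
    and hzero_left: "x \<in> carrier F \<Longrightarrow> hzero F \<otimes> x = hzero F"
    and hzero_right: "x \<in> carrier F \<Longrightarrow> x \<otimes> hzero F = hzero F"

definition hyperfield_iso ::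
  "('a, 'c) hyperstructure_scheme \<Rightarrow> ('b, 'd) hyperstructure_scheme \<Rightarrow> ('a \<Rightarrow> 'b) \<Rightarrow> bool" where
  "hyperfield_iso F K f \<longleftrightarrow>
     bij_betw f (carrier F) (carrier K) \<and>
     f (hzero F) = hzero K \<and> f \<one>\<^bsub>F\<^esub> = \<one>\<^bsub>K\<^esub> \<and>
     (\<forall>x \<in> carrier F. \<forall>y \<in> carrier F.
        f (x \<otimes>\<^bsub>F\<^esub> y) = f x \<otimes>\<^bsub>K\<^esub> f y \<and>
        f ` (x \<boxplus>\<^bsub>F\<^esub> y) = f x \<boxplus>\<^bsub>K\<^esub> f y)"

definition hyperfield_isomorphic ::
  "('a, 'c) hyperstructure_scheme \<Rightarrow> ('b, 'd) hyperstructure_scheme \<Rightarrow> bool"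
  (infix \<open>\<cong>\<^sub>h\<close> 50) where
  "F \<cong>\<^sub>h K \<longleftrightarrow> (\<exists>f. hyperfield_iso F K f)"


section \<open>Characteristics\<close>

text \<open>The value at 0 is a dummy; only positive multiples of 1 are used below.\<close>

fun hmultiple :: "('a, 'b) hyperstructure_scheme \<Rightarrow> nat \<Rightarrow> 'a set" where
  "hmultiple F 0 = {hzero F}"
| "hmultiple F (Suc 0) = {\<one>\<^bsub>F\<^esub>}"
| "hmultiple F (Suc (Suc n)) = hadd_set F (hmultiple F (Suc n)) \<one>\<^bsub>F\<^esub>"

definition hchar :: "('a, 'b) hyperstructure_scheme \<Rightarrow> enat" where
  "hchar F =
     (if \<exists>n\<ge>1. hzero F \<in> hmultiple F n
      then enat (LEAST n. n \<ge> 1 \<and> hzero F \<in> hmultiple F n) else \<infinity>)"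

definition C_char :: "('a, 'b) hyperstructure_scheme \<Rightarrow> enat" where
  "C_char F =
     (if \<exists>n\<ge>1. \<one>\<^bsub>F\<^esub> \<in> hmultiple F (n + 1)
      then enat (LEAST n. n \<ge> 1 \<and> \<one>\<^bsub>F\<^esub> \<in> hmultiple F (n + 1)) else \<infinity>)"


section \<open>Krasner quotients\<close>

definition index_subgroup :: "('a, 'b) ring_scheme \<Rightarrow> nat \<Rightarrow> 'a set" where
  "index_subgroup R r =
     (THE H. subgroup H (mult_of R) \<and> card (rcosets\<^bsub>mult_of R\<^esub> H) = r)"

text \<open>The class \<open>[x]\<close> is the coset \<open>x <# G\<close>. For \<open>x = \<zero>\<close> this is \<open>{\<zero>}\<close>, which
  serves as the zero of the quotient and is absorbing for the product of subsets. The
  hypersum below ranges over all representatives \<open>x\<close>, \<open>y\<close> of the two classes; it does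
  not depend on them, see \<open>krasner_hadd\<close>.\<close>

definition krasner_quotient :: "('a, 'b) ring_scheme \<Rightarrow> 'a set \<Rightarrow> 'a set hyperstructure" where
  "krasner_quotient R G =
     \<lparr>carrier = {x <#\<^bsub>R\<^esub> G | x. x \<in> carrier R},
      monoid.mult = (\<lambda>A B. A <#>\<^bsub>R\<^esub> B),
      one = \<one>\<^bsub>R\<^esub> <#\<^bsub>R\<^esub> G,
      hzero = \<zero>\<^bsub>R\<^esub> <#\<^bsub>R\<^esub> G,
      hadd = (\<lambda>A B. {(x \<oplus>\<^bsub>R\<^esub> y \<otimes>\<^bsub>R\<^esub> g) <#\<^bsub>R\<^esub> G | x y g. x \<in> A \<and> y \<in> B \<and> g \<in> G})\<rparr>"


section \<open>The stable models\<close>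

text \<open>\<open>None\<close> is the zero and \<open>Some i\<close> with \<open>i < r\<close> is the power \<open>g ^ i\<close> of a fixed
  generator \<open>g\<close> of the cyclic group of order \<open>r\<close>; for even \<open>r\<close> the element of order 2
  is \<open>g ^ (r div 2)\<close>.\<close>

definition cyc_carrier :: "nat \<Rightarrow> nat option set" where
  "cyc_carrier r = insert None (Some ` {..<r})"

fun cyc_mult :: "nat \<Rightarrow> nat option \<Rightarrow> nat option \<Rightarrow> nat option" where
  "cyc_mult r (Some i) (Some j) = Some ((i + j) mod r)"
| "cyc_mult r _ _ = None"

fun stable_hadd :: "nat \<Rightarrow> nat option \<Rightarrow> nat option \<Rightarrow> nat option set" where
  "stable_hadd r None b = {b}"
| "stable_hadd r a None = {a}"
| "stable_hadd r (Some i) (Some j) =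
     (if j = i then cyc_carrier r else cyc_carrier r - {None})"

fun stable_hadd' :: "nat \<Rightarrow> nat option \<Rightarrow> nat option \<Rightarrow> nat option set" where
  "stable_hadd' r None b = {b}"
| "stable_hadd' r a None = {a}"
| "stable_hadd' r (Some i) (Some j) =
     (if Some j = cyc_mult r (Some (r div 2)) (Some i)
      then cyc_carrier r else cyc_carrier r - {None})"

definition stable_H :: "nat \<Rightarrow> nat option hyperstructure" where
  "stable_H r =
     \<lparr>carrier = cyc_carrier r, monoid.mult = cyc_mult r, one = Some 0,
      hzero = None, hadd = stable_hadd r\<rparr>"

definition stable_H' :: "nat \<Rightarrow> nat option hyperstructure" where
  "stable_H' r =
     \<lparr>carrier = cyc_carrier r, monoid.mult = cyc_mult r, one = Some 0,
      hzero = None, hadd = stable_hadd' r\<rparr>"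


section \<open>Baker--Jin thresholds\<close>

text \<open>Every finite field is isomorphic to one whose carrier is a set of natural numbers,
  so that quantifying over \<open>nat ring\<close> covers all finite fields.\<close>

definition baker_jin_threshold :: "nat \<Rightarrow> nat \<Rightarrow> bool" where
  "baker_jin_threshold r N \<longleftrightarrow> N > 0 \<and>
     (\<forall>q (R :: nat ring).
        primepow q \<and> q \<ge> N \<and> r dvd (q - 1) \<and> field R \<and> order R = q \<longrightarrow>
          (odd r \<longrightarrow>
             krasner_quotient R (index_subgroup R r) \<cong>\<^sub>h stable_H r) \<and>
          (even r \<longrightarrow>
             ([q = 1] (mod (2 * r)) \<longrightarrow>
                krasner_quotient R (index_subgroup R r) \<cong>\<^sub>h stable_H r) \<and>
             ([q = r + 1] (mod (2 * r)) \<longrightarrow>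
                krasner_quotient R (index_subgroup R r) \<cong>\<^sub>h stable_H' r)))"


section \<open>Well-definedness\<close>

lemma index_subgroup_ex1:
  fixes R :: "('a, 'b) ring_scheme" (structure)
  assumes R: "field R" and fin: "finite (carrier R)" and r: "r dvd order R - 1"
  shows "\<exists>!H. subgroup H (mult_of R) \<and> card (rcosets\<^bsub>mult_of R\<^esub> H) = r"
proof -
  interpret field R by fact
  interpret M: group "mult_of R" by (rule field_mult_group)
  have finM: "finite (carrier (mult_of R))" using fin by simp
  have ordM: "order (mult_of R) = order R - 1" using fin by (rule order_mult_of)
  have pos: "order R - 1 > 0"
    using finM ordM M.order_gt_0_iff_finite by auto
  define m where "m = (order R - 1) div r"
  have m: "order R - 1 = r * m" using r by (simp add: m_def)
  have "r * m > 0" by (rule pos[unfolded m])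
  hence mpos: "m > 0" and rpos: "r > 0" by simp_all
  define S where "S = {x \<in> carrier R. x [^] m = \<one>}"
  have finS: "finite S" using fin by (simp add: S_def)
  have cardS: "card S \<le> m"
    unfolding S_def using num_roots_le_deg[OF fin] mpos by blast
  have cardsub: "card H = m \<and> H \<subseteq> S"
    if H: "subgroup H (mult_of R)" and idx: "card (rcosets\<^bsub>mult_of R\<^esub> H) = r" for H
  proof -
    have sub: "H \<subseteq> carrier (mult_of R)" using H by (rule subgroup.subset)
    have "r * card H = order (mult_of R)"
      using M.lagrange_finite[OF finM H] idx by simp
    hence c: "card H = m" using ordM m rpos by simp
    have "x \<in> S" if x: "x \<in> H" for x
    proof -
      interpret HG: group "mult_of R \<lparr>carrier := H\<rparr>"
        using H M.subgroup_imp_group by blast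
      have "x [^]\<^bsub>mult_of R \<lparr>carrier := H\<rparr>\<^esub> order (mult_of R \<lparr>carrier := H\<rparr>)
          = \<one>\<^bsub>mult_of R \<lparr>carrier := H\<rparr>\<^esub>"
        by (rule HG.pow_order_eq_1) (simp add: x)
      hence "x [^]\<^bsub>mult_of R\<^esub> m = \<one>"
        using c by (simp add: order_def nat_pow_def)
      thus ?thesis using x sub by (auto simp: S_def nat_pow_mult_of)
    qed
    thus ?thesis using c by auto
  qed
  have uniq: "H = S"
    if "subgroup H (mult_of R)" "card (rcosets\<^bsub>mult_of R\<^esub> H) = r" for H
    using cardsub[OF that] cardS finS by (simp add: card_seteq)
  obtain a where a: "a \<in> carrier (mult_of R)"
    and gen: "carrier (mult_of R) = {a [^] i | i::nat. i \<in> UNIV}"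
    using finite_field_mult_group_has_gen[OF fin] by auto
  have "M.ord a = order (mult_of R)"
  proof -
    have "generate (mult_of R) {a} = {a [^]\<^bsub>mult_of R\<^esub> k | k. k \<in> (UNIV :: nat set)}"
      using M.generate_pow_on_finite_carrier[OF finM a] .
    hence "generate (mult_of R) {a} = carrier (mult_of R)"
      using gen by (simp add: nat_pow_mult_of)
    thus ?thesis using M.generate_pow_card[OF a] by (simp add: order_def)
  qed
  hence orda: "M.ord a = r * m" using ordM m by simp
  define b where "b = a [^]\<^bsub>mult_of R\<^esub> r"
  have b: "b \<in> carrier (mult_of R)" unfolding b_def using a by (rule M.nat_pow_closed)
  have "M.ord b = m"
    unfolding b_def using M.ord_pow[OF a, of r] orda rpos by simp
  hence cg: "card (generate (mult_of R) {b}) = m" using M.generate_pow_card[OF b] by simp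
  have sg: "subgroup (generate (mult_of R) {b}) (mult_of R)"
    using b by (intro M.generate_is_subgroup) simp
  have "card (rcosets\<^bsub>mult_of R\<^esub> generate (mult_of R) {b}) = r"
    using M.lagrange_finite[OF finM sg] cg ordM m mpos by simp
  with sg uniq show ?thesis by (intro ex1I[of _ "generate (mult_of R) {b}"]) auto
qed

context
  fixes R :: "('a, 'b) ring_scheme" (structure) and G :: "'a set"
  assumes field_R: "field R" and subgroup_G: "subgroup G (mult_of R)"
begin

interpretation field R by (rule field_R)
interpretation M: group "mult_of R" by (rule field_mult_group)

lemma G_props:
  "\<And>g. g \<in> G \<Longrightarrow> g \<in> carrier R" "\<And>g. g \<in> G \<Longrightarrow> g \<noteq> \<zero>" "\<one> \<in> G"
  "\<And>g h. \<lbrakk>g \<in> G; h \<in> G\<rbrakk> \<Longrightarrow> g \<otimes> h \<in> G"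
  "\<And>g. g \<in> G \<Longrightarrow> \<exists>h\<in>G. g \<otimes> h = \<one>"
proof -
  fix g assume "g \<in> G"
  thus "\<exists>h\<in>G. g \<otimes> h = \<one>"
    using subgroup.m_inv_closed[OF subgroup_G] subgroup.subset[OF subgroup_G] M.r_inv
    by (metis mult_mult_of one_mult_of subsetD)
qed (use subgroup.subset[OF subgroup_G] subgroup.one_closed[OF subgroup_G]
      subgroup.m_closed[OF subgroup_G] in auto)

lemma class_iff: "z \<in> x <# G \<longleftrightarrow> (\<exists>g\<in>G. z = x \<otimes> g)"
  by (auto simp: l_coset_def)

lemma class_eq_iff:
  assumes "x \<in> carrier R" "z \<in> carrier R"
  shows "z <# G = x <# G \<longleftrightarrow> (\<exists>g\<in>G. z = x \<otimes> g)"
proof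
  assume "z <# G = x <# G"
  moreover have "z \<in> z <# G" using G_props(3) assms by (auto simp: class_iff intro!: bexI[of _ \<one>])
  ultimately show "\<exists>g\<in>G. z = x \<otimes> g" by (simp add: class_iff)
next
  assume "\<exists>g\<in>G. z = x \<otimes> g"
  then obtain g where g: "g \<in> G" "z = x \<otimes> g" by blast
  then obtain h where h: "h \<in> G" "g \<otimes> h = \<one>" using G_props(5) by blast
  note c = G_props(1)
  have "w \<in> x <# G" if "w \<in> z <# G" for w
    using that g assms c G_props(4) by (auto simp: class_iff m_assoc)
  moreover have "w \<in> z <# G" if "w \<in> x <# G" for w
  proof -
    obtain k where k: "k \<in> G" "w = x \<otimes> k" using \<open>w \<in> x <# G\<close> by (auto simp: class_iff)
    have "z \<otimes> (h \<otimes> k) = x \<otimes> ((g \<otimes> h) \<otimes> k)"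
      using g h(1) k assms c by (simp add: m_assoc)
    hence "w = z \<otimes> (h \<otimes> k)" using h k c by simp
    thus ?thesis using h k G_props(4) by (auto simp: class_iff)
  qed
  ultimately show "z <# G = x <# G" by blast
qed

lemma krasner_hadd_mem:
  assumes "x \<in> carrier R" "y \<in> carrier R"
  shows "C \<in> (x <# G) \<boxplus>\<^bsub>krasner_quotient R G\<^esub> (y <# G) \<longleftrightarrow>
    (\<exists>g\<in>G. \<exists>h\<in>G. C = (x \<otimes> g \<oplus> y \<otimes> h) <# G)"
proof
  assume "C \<in> (x <# G) \<boxplus>\<^bsub>krasner_quotient R G\<^esub> (y <# G)"
  then obtain a b k where "a \<in> G" "b \<in> G" "k \<in> G" "C = (x \<otimes> a \<oplus> y \<otimes> b \<otimes> k) <# G"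
    by (auto simp: krasner_quotient_def class_iff)
  thus "\<exists>g\<in>G. \<exists>h\<in>G. C = (x \<otimes> g \<oplus> y \<otimes> h) <# G"
    using assms G_props(1,4) by (metis m_assoc)
next
  assume "\<exists>g\<in>G. \<exists>h\<in>G. C = (x \<otimes> g \<oplus> y \<otimes> h) <# G"
  then obtain g h where gh: "g \<in> G" "h \<in> G" "C = (x \<otimes> g \<oplus> y \<otimes> h) <# G" by blast
  have "x \<otimes> g \<in> x <# G" "y \<otimes> h \<in> y <# G" using gh by (auto simp: class_iff)
  have "y \<otimes> h \<otimes> \<one> = y \<otimes> h" using gh assms G_props(1) by simp
  show "C \<in> (x <# G) \<boxplus>\<^bsub>krasner_quotient R G\<^esub> (y <# G)"
  proof -
    have "C = (x \<otimes> g \<oplus> y \<otimes> h \<otimes> \<one>) <# G" using gh(3) \<open>y \<otimes> h \<otimes> \<one> = y \<otimes> h\<close> by simp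
    hence "\<exists>a b k. C = (a \<oplus> b \<otimes> k) <# G \<and> a \<in> x <# G \<and> b \<in> y <# G \<and> k \<in> G"
      using \<open>x \<otimes> g \<in> x <# G\<close> \<open>y \<otimes> h \<in> y <# G\<close> G_props(3) by blast
    thus ?thesis by (simp add: krasner_quotient_def)
  qed
qed

lemma krasner_hadd:
  assumes x: "x \<in> carrier R" and y: "y \<in> carrier R"
  shows "(x <# G) \<boxplus>\<^bsub>krasner_quotient R G\<^esub> (y <# G) = {(x \<oplus> y \<otimes> g) <# G | g. g \<in> G}"
proof (intro Set.set_eqI iffI)
  fix C assume "C \<in> (x <# G) \<boxplus>\<^bsub>krasner_quotient R G\<^esub> (y <# G)"
  then obtain g h where gh: "g \<in> G" "h \<in> G" "C = (x \<otimes> g \<oplus> y \<otimes> h) <# G"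
    using krasner_hadd_mem[OF assms] by blast
  obtain k where k: "k \<in> G" "g \<otimes> k = \<one>" using gh G_props(5) by blast
  note c = G_props(1)[OF gh(1)] G_props(1)[OF gh(2)] G_props(1)[OF k(1)]
  have "(x \<oplus> y \<otimes> (h \<otimes> k)) \<otimes> g = x \<otimes> g \<oplus> y \<otimes> h \<otimes> (g \<otimes> k)"
    using c x y by algebra
  hence "x \<otimes> g \<oplus> y \<otimes> h = (x \<oplus> y \<otimes> (h \<otimes> k)) \<otimes> g" using c k x y by simp
  hence "C = (x \<oplus> y \<otimes> (h \<otimes> k)) <# G"
    using gh c x y class_eq_iff[of "x \<oplus> y \<otimes> (h \<otimes> k)" "x \<otimes> g \<oplus> y \<otimes> h"] by auto
  thus "C \<in> {(x \<oplus> y \<otimes> g) <# G | g. g \<in> G}" using gh k G_props(4) by blast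
next
  fix C assume "C \<in> {(x \<oplus> y \<otimes> g) <# G | g. g \<in> G}"
  then obtain g where "g \<in> G" "C = (x \<otimes> \<one> \<oplus> y \<otimes> g) <# G" using x by auto
  thus "C \<in> (x <# G) \<boxplus>\<^bsub>krasner_quotient R G\<^esub> (y <# G)"
    using krasner_hadd_mem[OF assms] G_props(3) by blast
qed

lemma krasner_mult:
  assumes x: "x \<in> carrier R" and y: "y \<in> carrier R"
  shows "(x <# G) \<otimes>\<^bsub>krasner_quotient R G\<^esub> (y <# G) = (x \<otimes> y) <# G"
proof (intro Set.set_eqI iffI)
  fix w assume "w \<in> (x <# G) \<otimes>\<^bsub>krasner_quotient R G\<^esub> (y <# G)"
  then obtain g h where gh: "g \<in> G" "h \<in> G" "w = x \<otimes> g \<otimes> (y \<otimes> h)"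
    by (auto simp: krasner_quotient_def set_mult_def class_iff)
  have "w = x \<otimes> y \<otimes> (g \<otimes> h)"
    using gh(3) G_props(1)[OF gh(1)] G_props(1)[OF gh(2)] x y by algebra
  thus "w \<in> (x \<otimes> y) <# G" using gh G_props(4) by (auto simp: class_iff)
next
  fix w assume "w \<in> (x \<otimes> y) <# G"
  then obtain g where g: "g \<in> G" "w = x \<otimes> y \<otimes> g" by (auto simp: class_iff)
  have "w = x \<otimes> \<one> \<otimes> (y \<otimes> g)"
    using g(2) G_props(1)[OF g(1)] x y by algebra
  thus "w \<in> (x <# G) \<otimes>\<^bsub>krasner_quotient R G\<^esub> (y <# G)"
  proof -
    have "x \<otimes> \<one> \<in> x <# G" "y \<otimes> g \<in> y <# G" using g G_props(3) by (auto simp: class_iff)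
    with \<open>w = x \<otimes> \<one> \<otimes> (y \<otimes> g)\<close> have "\<exists>a \<in> x <# G. \<exists>b \<in> y <# G. w = a \<otimes> b" by blast
    thus ?thesis by (simp add: krasner_quotient_def set_mult_def)
  qed
qed

lemma class_zero: "\<zero> <# G = {\<zero>}"
  using G_props(1,3) by (auto simp: class_iff)

lemma class_zero_iff: "x \<in> carrier R \<Longrightarrow> x <# G = {\<zero>} \<longleftrightarrow> x = \<zero>"
  using class_eq_iff[of \<zero> x] G_props(1,3) by (auto simp: class_zero)

lemma krasner_carrier:
  "carrier (krasner_quotient R G) = insert {\<zero>} (rcosets\<^bsub>mult_of R\<^esub> G)"
proof -
  have "x <# G = G #>\<^bsub>mult_of R\<^esub> x" if "x \<in> carrier R" for x
    using that G_props(1) by (auto simp: l_coset_def r_coset_def m_comm)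
  hence rc: "rcosets\<^bsub>mult_of R\<^esub> G = (\<lambda>x. x <# G) ` (carrier R - {\<zero>})"
    by (auto simp: RCOSETS_def)
  have "carrier R = insert \<zero> (carrier R - {\<zero>})" by auto
  hence "(\<lambda>x. x <# G) ` carrier R = insert (\<zero> <# G) ((\<lambda>x. x <# G) ` (carrier R - {\<zero>}))"
    by (metis image_insert)
  moreover have "carrier (krasner_quotient R G) = (\<lambda>x. x <# G) ` carrier R"
    by (auto simp: krasner_quotient_def)
  ultimately show ?thesis by (simp add: rc class_zero)
qed

lemma krasner_quotient_hyperfield: "hyperfield (krasner_quotient R G)"
proof -
  let ?K = "krasner_quotient R G"
  have car: "C \<in> carrier ?K \<longleftrightarrow> (\<exists>x \<in> carrier R. C = x <# G)" for C
    by (auto simp: krasner_quotient_def)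
  have z: "hzero ?K = {\<zero>}" by (simp add: krasner_quotient_def class_zero)
  have z': "hzero ?K = \<zero> <# G" by (simp add: krasner_quotient_def)
  have o: "\<one>\<^bsub>?K\<^esub> = \<one> <# G" by (simp add: krasner_quotient_def)
  note c = G_props(1)
  note mem = krasner_hadd_mem
  have cl: "x \<otimes> g \<oplus> y \<otimes> h \<in> carrier R"
    if "x \<in> carrier R" "y \<in> carrier R" "g \<in> G" "h \<in> G" for x y g h
    using that c by simp
  have comm: "A \<boxplus>\<^bsub>?K\<^esub> B = B \<boxplus>\<^bsub>?K\<^esub> A" if ps: "A \<in> carrier ?K" "B \<in> carrier ?K" for A B
  proof -
    obtain x y where xy: "x \<in> carrier R" "y \<in> carrier R" "A = x <# G" "B = y <# G"
      using ps unfolding car by blast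
    have sw: "x \<otimes> g \<oplus> y \<otimes> h = y \<otimes> h \<oplus> x \<otimes> g" if "g \<in> G" "h \<in> G" for g h
      using xy(1,2) c that by (simp add: a_comm)
    have e: "(\<exists>g\<in>G. \<exists>h\<in>G. C = (x \<otimes> g \<oplus> y \<otimes> h) <# G)
        \<longleftrightarrow> (\<exists>g\<in>G. \<exists>h\<in>G. C = (y \<otimes> h \<oplus> x \<otimes> g) <# G)" for C
      using sw by (intro bex_cong refl) simp
    have "C \<in> A \<boxplus>\<^bsub>?K\<^esub> B \<longleftrightarrow> C \<in> B \<boxplus>\<^bsub>?K\<^esub> A" for C
      unfolding xy(3,4) mem[OF xy(1,2)] mem[OF xy(2,1)] e by blast
    thus ?thesis by blast
  qed
  have closed: "A \<boxplus>\<^bsub>?K\<^esub> B \<subseteq> carrier ?K" if ps: "A \<in> carrier ?K" "B \<in> carrier ?K" for A B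
  proof -
    obtain x y where xy: "x \<in> carrier R" "y \<in> carrier R" "A = x <# G" "B = y <# G"
      using ps unfolding car by blast
    show ?thesis
    proof
      fix C assume "C \<in> A \<boxplus>\<^bsub>?K\<^esub> B"
      then obtain g h where "g \<in> G" "h \<in> G" "C = (x \<otimes> g \<oplus> y \<otimes> h) <# G"
        unfolding xy(3,4) mem[OF xy(1,2)] by blast
      thus "C \<in> carrier ?K" using cl[OF xy(1,2)] unfolding car by blast
    qed
  qed
  have tri: "w <# G \<in> (\<Union>D \<in> (x <# G) \<boxplus>\<^bsub>?K\<^esub> (y <# G). D \<boxplus>\<^bsub>?K\<^esub> (v <# G)) \<longleftrightarrow>
      (\<exists>g\<in>G. \<exists>h\<in>G. \<exists>k\<in>G. w <# G = (x \<otimes> g \<oplus> y \<otimes> h \<oplus> v \<otimes> k) <# G)"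
    if xyv: "x \<in> carrier R" "y \<in> carrier R" "v \<in> carrier R" for w x y v
  proof
    assume "w <# G \<in> (\<Union>D \<in> (x <# G) \<boxplus>\<^bsub>?K\<^esub> (y <# G). D \<boxplus>\<^bsub>?K\<^esub> (v <# G))"
    then obtain D where D: "D \<in> (x <# G) \<boxplus>\<^bsub>?K\<^esub> (y <# G)"
      "w <# G \<in> D \<boxplus>\<^bsub>?K\<^esub> (v <# G)" by blast
    obtain a b where ab: "a \<in> G" "b \<in> G" and D': "D = (x \<otimes> a \<oplus> y \<otimes> b) <# G"
      using D(1) unfolding mem[OF xyv(1,2)] by blast
    obtain d e where de: "d \<in> G" "e \<in> G"
      and w: "w <# G = ((x \<otimes> a \<oplus> y \<otimes> b) \<otimes> d \<oplus> v \<otimes> e) <# G"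
      using D(2) unfolding D' mem[OF cl[OF xyv(1,2) ab] xyv(3)] by blast
    have "(x \<otimes> a \<oplus> y \<otimes> b) \<otimes> d \<oplus> v \<otimes> e = x \<otimes> (a \<otimes> d) \<oplus> y \<otimes> (b \<otimes> d) \<oplus> v \<otimes> e"
      using xyv c[OF ab(1)] c[OF ab(2)] c[OF de(1)] c[OF de(2)] by algebra
    hence "w <# G = (x \<otimes> (a \<otimes> d) \<oplus> y \<otimes> (b \<otimes> d) \<oplus> v \<otimes> e) <# G" using w by simp
    thus "\<exists>g\<in>G. \<exists>h\<in>G. \<exists>k\<in>G. w <# G = (x \<otimes> g \<oplus> y \<otimes> h \<oplus> v \<otimes> k) <# G"
      using G_props(4)[OF ab(1) de(1)] G_props(4)[OF ab(2) de(1)] de(2) by blast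
  next
    assume "\<exists>g\<in>G. \<exists>h\<in>G. \<exists>k\<in>G. w <# G = (x \<otimes> g \<oplus> y \<otimes> h \<oplus> v \<otimes> k) <# G"
    then obtain g h k where ghk: "g \<in> G" "h \<in> G" "k \<in> G"
      and w: "w <# G = (x \<otimes> g \<oplus> y \<otimes> h \<oplus> v \<otimes> k) <# G" by blast
    have "w <# G = ((x \<otimes> g \<oplus> y \<otimes> h) \<otimes> \<one> \<oplus> v \<otimes> k) <# G"
      using w cl[OF xyv(1,2) ghk(1,2)] by simp
    hence "w <# G \<in> ((x \<otimes> g \<oplus> y \<otimes> h) <# G) \<boxplus>\<^bsub>?K\<^esub> (v <# G)"
      unfolding mem[OF cl[OF xyv(1,2) ghk(1,2)] xyv(3)] using ghk G_props(3) by blast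
    moreover have "(x \<otimes> g \<oplus> y \<otimes> h) <# G \<in> (x <# G) \<boxplus>\<^bsub>?K\<^esub> (y <# G)"
      unfolding mem[OF xyv(1,2)] using ghk by blast
    ultimately show "w <# G \<in> (\<Union>D \<in> (x <# G) \<boxplus>\<^bsub>?K\<^esub> (y <# G). D \<boxplus>\<^bsub>?K\<^esub> (v <# G))"
      by blast
  qed
  have assoc: "hadd_set ?K (A \<boxplus>\<^bsub>?K\<^esub> B) C = (\<Union>D \<in> B \<boxplus>\<^bsub>?K\<^esub> C. A \<boxplus>\<^bsub>?K\<^esub> D)"
    if ps: "A \<in> carrier ?K" "B \<in> carrier ?K" "C \<in> carrier ?K" for A B C
  proof -
    obtain x y v where xyv: "x \<in> carrier R" "y \<in> carrier R" "v \<in> carrier R"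
      "A = x <# G" "B = y <# G" "C = v <# G"
      using ps unfolding car by blast
    have eq: "(\<Union>D \<in> B \<boxplus>\<^bsub>?K\<^esub> C. A \<boxplus>\<^bsub>?K\<^esub> D) = (\<Union>D \<in> B \<boxplus>\<^bsub>?K\<^esub> C. D \<boxplus>\<^bsub>?K\<^esub> A)"
    proof (rule SUP_cong[OF refl])
      fix D assume "D \<in> B \<boxplus>\<^bsub>?K\<^esub> C"
      hence "D \<in> carrier ?K" using closed[OF ps(2,3)] by blast
      thus "A \<boxplus>\<^bsub>?K\<^esub> D = D \<boxplus>\<^bsub>?K\<^esub> A" by (rule comm[OF ps(1)])
    qed
    have L: "hadd_set ?K (A \<boxplus>\<^bsub>?K\<^esub> B) C \<subseteq> carrier ?K"
      unfolding hadd_set_def using closed[OF _ ps(3)] closed[OF ps(1,2)] by blast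
    have Rr: "(\<Union>D \<in> B \<boxplus>\<^bsub>?K\<^esub> C. D \<boxplus>\<^bsub>?K\<^esub> A) \<subseteq> carrier ?K"
      using closed[OF _ ps(1)] closed[OF ps(2,3)] by blast
    have E: "w <# G \<in> hadd_set ?K (A \<boxplus>\<^bsub>?K\<^esub> B) C \<longleftrightarrow> w <# G \<in> (\<Union>D \<in> B \<boxplus>\<^bsub>?K\<^esub> C. D \<boxplus>\<^bsub>?K\<^esub> A)" for w
    proof -
      have *: "x \<otimes> g \<oplus> y \<otimes> h \<oplus> v \<otimes> k = y \<otimes> h \<oplus> v \<otimes> k \<oplus> x \<otimes> g"
        if "g \<in> G" "h \<in> G" "k \<in> G" for g h k
        using xyv(1-3) c[OF that(1)] c[OF that(2)] c[OF that(3)] by algebra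
      show ?thesis
        unfolding hadd_set_def xyv(4-6) tri[OF xyv(1-3)] tri[OF xyv(2,3,1)]
        using * by (simp cong: bex_cong) blast
    qed
    have "hadd_set ?K (A \<boxplus>\<^bsub>?K\<^esub> B) C = (\<Union>D \<in> B \<boxplus>\<^bsub>?K\<^esub> C. D \<boxplus>\<^bsub>?K\<^esub> A)"
      (is "?X = ?Y")
    proof (rule Set.set_eqI)
      fix D
      show "D \<in> ?X \<longleftrightarrow> D \<in> ?Y"
      proof (cases "D \<in> carrier ?K")
        case True
        then obtain w where "D = w <# G" unfolding car by blast
        thus ?thesis using E by simp
      next
        case False thus ?thesis using L Rr by blast
      qed
    qed
    thus ?thesis using eq by simp
  qed
  have neg: "hzero ?K \<in> (x <# G) \<boxplus>\<^bsub>?K\<^esub> (y <# G) \<longleftrightarrow> y <# G = (\<ominus> x) <# G"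
    if xy: "x \<in> carrier R" "y \<in> carrier R" for x y
  proof
    assume "hzero ?K \<in> (x <# G) \<boxplus>\<^bsub>?K\<^esub> (y <# G)"
    then obtain g where g: "g \<in> G" "(x \<oplus> y \<otimes> g) <# G = {\<zero>}"
      unfolding z krasner_hadd[OF xy] by auto
    hence "x \<oplus> y \<otimes> g = \<zero>" using class_zero_iff c xy by simp
    hence "\<ominus> x = y \<otimes> g" using xy c[OF g(1)] by (metis a_comm m_closed minus_equality)
    thus "y <# G = (\<ominus> x) <# G"
      using class_eq_iff[OF xy(2) a_inv_closed[OF xy(1)]] g(1) by blast
  next
    assume "y <# G = (\<ominus> x) <# G"
    then obtain g where g: "g \<in> G" "\<ominus> x = y \<otimes> g"
      using class_eq_iff[OF xy(2) a_inv_closed[OF xy(1)]] by metis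
    hence "x \<oplus> y \<otimes> g = \<zero>" using xy by (metis r_neg)
    thus "hzero ?K \<in> (x <# G) \<boxplus>\<^bsub>?K\<^esub> (y <# G)"
      unfolding z' krasner_hadd[OF xy] using g(1)
      by (metis (mono_tags, lifting) mem_Collect_eq)
  qed
  have hneg: "hneg ?K (x <# G) = (\<ominus> x) <# G" if "x \<in> carrier R" for x
    unfolding hneg_def
  proof (rule the_equality)
    show "(\<ominus> x) <# G \<in> carrier ?K \<and> hzero ?K \<in> (x <# G) \<boxplus>\<^bsub>?K\<^esub> ((\<ominus> x) <# G)"
      using neg[OF that a_inv_closed[OF that]] that car by blast
  next
    fix C assume "C \<in> carrier ?K \<and> hzero ?K \<in> (x <# G) \<boxplus>\<^bsub>?K\<^esub> C"
    thus "C = (\<ominus> x) <# G" using neg[OF that] unfolding car by blast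
  qed
  have zero_right: "A \<boxplus>\<^bsub>?K\<^esub> hzero ?K = {A}" if ps: "A \<in> carrier ?K" for A
  proof -
    obtain x where x: "x \<in> carrier R" "A = x <# G" using ps unfolding car by blast
    have "x \<oplus> \<zero> \<otimes> g = x" if "g \<in> G" for g using x c that by simp
    thus ?thesis unfolding z' x(2) krasner_hadd[OF x(1) zero_closed]
      using G_props(3) x(1) by (auto intro!: exI[of _ \<one>])
  qed
  have rev: "B \<in> C \<boxplus>\<^bsub>?K\<^esub> hneg ?K A"
    if ps: "A \<in> carrier ?K" "B \<in> carrier ?K" "C \<in> A \<boxplus>\<^bsub>?K\<^esub> B" for A B C
  proof -
    obtain x y where xy: "x \<in> carrier R" "y \<in> carrier R" "A = x <# G" "B = y <# G"
      using ps unfolding car by blast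
    obtain g where g: "g \<in> G" "C = (y \<oplus> x \<otimes> g) <# G"
      using ps(3) comm[OF ps(1,2)] krasner_hadd[OF xy(2,1)] xy by auto
    have "y \<oplus> x \<otimes> g \<oplus> \<ominus> x \<otimes> g = y" using xy c[OF g(1)] by algebra
    hence B: "B = (y \<oplus> x \<otimes> g \<oplus> \<ominus> x \<otimes> g) <# G" using xy by simp
    have yx: "y \<oplus> x \<otimes> g \<in> carrier R" using xy c[OF g(1)] by simp
    have "C \<boxplus>\<^bsub>?K\<^esub> hneg ?K A = {(y \<oplus> x \<otimes> g \<oplus> \<ominus> x \<otimes> h) <# G | h. h \<in> G}"
      unfolding xy(3) hneg[OF xy(1)] g(2) krasner_hadd[OF yx a_inv_closed[OF xy(1)]] ..
    thus ?thesis using B g(1) by blast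
  qed
  have mult_comm: "A \<otimes>\<^bsub>?K\<^esub> B = B \<otimes>\<^bsub>?K\<^esub> A" if "A \<in> carrier ?K" "B \<in> carrier ?K" for A B
    using that unfolding car by (auto simp: krasner_mult m_comm)
  have mult_closed: "A \<otimes>\<^bsub>?K\<^esub> B \<in> carrier ?K" if "A \<in> carrier ?K" "B \<in> carrier ?K" for A B
    using that unfolding car by (auto simp: krasner_mult)
  have dist: "(\<lambda>D. A \<otimes>\<^bsub>?K\<^esub> D) ` (B \<boxplus>\<^bsub>?K\<^esub> C) = (A \<otimes>\<^bsub>?K\<^esub> B) \<boxplus>\<^bsub>?K\<^esub> (A \<otimes>\<^bsub>?K\<^esub> C)"
    if ps: "A \<in> carrier ?K" "B \<in> carrier ?K" "C \<in> carrier ?K" for A B C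
  proof -
    obtain x y v where xyv: "x \<in> carrier R" "y \<in> carrier R" "v \<in> carrier R"
      "A = x <# G" "B = y <# G" "C = v <# G"
      using ps unfolding car by blast
    have "(x <# G) \<otimes>\<^bsub>?K\<^esub> ((y \<oplus> v \<otimes> g) <# G) = (x \<otimes> y \<oplus> (x \<otimes> v) \<otimes> g) <# G" if "g \<in> G" for g
      using krasner_mult[of x "y \<oplus> v \<otimes> g"] xyv c[OF that]
      by (simp add: r_distr m_assoc)
    thus ?thesis
      unfolding xyv(4-6) krasner_mult[OF xyv(1,2)] krasner_mult[OF xyv(1,3)]
        krasner_hadd[OF xyv(2,3)] krasner_hadd[OF m_closed[OF xyv(1,2)] m_closed[OF xyv(1,3)]]
      by (simp add: Setcompr_eq_image image_image cong: image_cong)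
  qed
  have ucar: "C \<in> carrier (hunits ?K) \<longleftrightarrow> (\<exists>x\<in>carrier R. x \<noteq> \<zero> \<and> C = x <# G)" for C
  proof -
    have "C \<in> carrier (hunits ?K) \<longleftrightarrow> C \<in> carrier ?K \<and> C \<noteq> {\<zero>}"
      by (simp add: hunits_def z)
    thus ?thesis unfolding car using class_zero_iff by blast
  qed
  have umult: "A \<otimes>\<^bsub>hunits ?K\<^esub> B = A \<otimes>\<^bsub>?K\<^esub> B" for A B by (simp add: hunits_def)
  have uone: "\<one>\<^bsub>hunits ?K\<^esub> = \<one> <# G" by (simp add: hunits_def o)
  have units: "comm_group (hunits ?K)"
  proof (rule comm_groupI; (unfold umult uone)?)
    show "\<one> <# G \<in> carrier (hunits ?K)" unfolding ucar using one_not_zero by blast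
  next
    fix A B assume AB: "A \<in> carrier (hunits ?K)" "B \<in> carrier (hunits ?K)"
    then obtain x y where xy: "x \<in> carrier R" "y \<in> carrier R" "A = x <# G" "B = y <# G"
      "x \<noteq> \<zero>" "y \<noteq> \<zero>"
      unfolding ucar by blast
    show "A \<otimes>\<^bsub>?K\<^esub> B \<in> carrier (hunits ?K)"
      unfolding xy(3,4) krasner_mult[OF xy(1,2)] ucar
      using m_closed[OF xy(1,2)] integral[OF _ xy(1,2)] xy(5,6) by blast
    show "A \<otimes>\<^bsub>?K\<^esub> B = B \<otimes>\<^bsub>?K\<^esub> A"
      using xy(1,2) by (simp add: xy(3,4) krasner_mult m_comm)
  next
    fix A B C assume "A \<in> carrier (hunits ?K)" "B \<in> carrier (hunits ?K)" "C \<in> carrier (hunits ?K)"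
    then obtain x y v where "x \<in> carrier R" "y \<in> carrier R" "v \<in> carrier R"
      "A = x <# G" "B = y <# G" "C = v <# G"
      unfolding ucar by blast
    thus "A \<otimes>\<^bsub>?K\<^esub> B \<otimes>\<^bsub>?K\<^esub> C = A \<otimes>\<^bsub>?K\<^esub> (B \<otimes>\<^bsub>?K\<^esub> C)"
      by (simp add: krasner_mult m_assoc)
  next
    fix A assume "A \<in> carrier (hunits ?K)"
    then obtain x where x: "x \<in> carrier R" "A = x <# G" "x \<noteq> \<zero>"
      unfolding ucar by blast
    show "(\<one> <# G) \<otimes>\<^bsub>?K\<^esub> A = A" using x by (simp add: krasner_mult)
    have "x \<in> Units R" using x field_Units by blast
    hence i: "inv x \<in> carrier R" "inv x \<otimes> x = \<one>" by simp_all
    hence "inv x \<noteq> \<zero>" using x(1) by auto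
    hence "(inv x) <# G \<in> carrier (hunits ?K)" unfolding ucar using i(1) by blast
    moreover have "((inv x) <# G) \<otimes>\<^bsub>?K\<^esub> A = \<one> <# G"
      using x i by (simp add: krasner_mult)
    ultimately show "\<exists>B \<in> carrier (hunits ?K). B \<otimes>\<^bsub>?K\<^esub> A = \<one> <# G" by blast
  qed
  have zabs: "A \<otimes>\<^bsub>?K\<^esub> hzero ?K = hzero ?K" if "A \<in> carrier ?K" for A
    using that unfolding z' car by (auto simp: krasner_mult)
  show ?thesis
  proof (intro hyperfield.intro canonical_hypergroup.intro hyperfield_axioms.intro)
    show zc: "hzero ?K \<in> carrier ?K" using car z' by auto
    show "A \<boxplus>\<^bsub>?K\<^esub> B \<noteq> {}" if "A \<in> carrier ?K" "B \<in> carrier ?K" for A B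
      using that G_props(3) unfolding car by (auto simp: krasner_hadd)
    show "\<exists>!B. B \<in> carrier ?K \<and> hzero ?K \<in> A \<boxplus>\<^bsub>?K\<^esub> B" if ps: "A \<in> carrier ?K" for A
    proof -
      obtain x where x: "x \<in> carrier R" "A = x <# G" using ps unfolding car by blast
      show ?thesis
      proof (rule ex1I[of _ "(\<ominus> x) <# G"])
        show "(\<ominus> x) <# G \<in> carrier ?K \<and> hzero ?K \<in> A \<boxplus>\<^bsub>?K\<^esub> ((\<ominus> x) <# G)"
          using neg[OF x(1) a_inv_closed[OF x(1)]] x car by blast
      next
        fix C assume "C \<in> carrier ?K \<and> hzero ?K \<in> A \<boxplus>\<^bsub>?K\<^esub> C"
        thus "C = (\<ominus> x) <# G" using neg[OF x(1)] unfolding car x(2) by blast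
      qed
    qed
    show "hzero ?K \<otimes>\<^bsub>?K\<^esub> A = hzero ?K" if "A \<in> carrier ?K" for A
      using zabs[OF that] mult_comm[OF that zc] by simp
    show "(\<lambda>D. D \<otimes>\<^bsub>?K\<^esub> A) ` (B \<boxplus>\<^bsub>?K\<^esub> C) = (B \<otimes>\<^bsub>?K\<^esub> A) \<boxplus>\<^bsub>?K\<^esub> (C \<otimes>\<^bsub>?K\<^esub> A)"
      if ABC: "A \<in> carrier ?K" "B \<in> carrier ?K" "C \<in> carrier ?K" for A B C
    proof -
      have "(\<lambda>D. D \<otimes>\<^bsub>?K\<^esub> A) ` (B \<boxplus>\<^bsub>?K\<^esub> C) = (\<lambda>D. A \<otimes>\<^bsub>?K\<^esub> D) ` (B \<boxplus>\<^bsub>?K\<^esub> C)"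
        using closed[OF ABC(2,3)] mult_comm ABC(1) by (intro image_cong) auto
      thus ?thesis using dist[OF ABC] mult_comm ABC by simp
    qed
  qed (fact closed comm assoc zero_right rev units dist zabs)+
qed

end

lemma cyc_units:
  fixes F :: "(nat option, 'b) hyperstructure_scheme"
  assumes "0 < r" and F: "carrier F = cyc_carrier r" "monoid.mult F = cyc_mult r" "\<one>\<^bsub>F\<^esub> = Some 0" "hzero F = None"
  shows "comm_group (hunits F)" and "order (hunits F) = r" and "cyclic_group (hunits F)"
proof -
  have car: "carrier (hunits F) = Some ` {..<r}"
    using F by (auto simp: hunits_def cyc_carrier_def)
  have mult: "x \<otimes>\<^bsub>hunits F\<^esub> y = cyc_mult r x y" for x y using F by (simp add: hunits_def)
  have one: "\<one>\<^bsub>hunits F\<^esub> = Some 0" using F by (simp add: hunits_def)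
  show cg: "comm_group (hunits F)"
  proof (rule comm_groupI; (unfold car mult one)?)
    fix x assume "x \<in> Some ` {..<r}"
    then obtain i where i: "x = Some i" "i < r" by auto
    show "\<exists>y\<in>Some ` {..<r}. cyc_mult r y x = Some 0"
      by (rule bexI[of _ "Some ((r - i) mod r)"]) (use i in \<open>auto simp: mod_simps\<close>)
  qed (use \<open>0 < r\<close> in \<open>auto simp: mod_simps ac_simps\<close>)
  show "order (hunits F) = r" by (simp add: order_def car card_image)
  interpret comm_group "hunits F" by (fact cg)
  have g: "Some (1 mod r) \<in> carrier (hunits F)" using assms(1) by (simp add: car)
  have pow: "Some (1 mod r) [^]\<^bsub>hunits F\<^esub> n = Some (n mod r)" for n :: nat
    by (induction n) (simp_all add: one mult mod_simps)
  have "carrier (hunits F) \<subseteq> range (\<lambda>n::int. Some (1 mod r) [^]\<^bsub>hunits F\<^esub> n)"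
  proof
    fix x assume "x \<in> carrier (hunits F)"
    then obtain i where "i < r" "x = Some i" by (auto simp: car)
    hence "x = Some (1 mod r) [^]\<^bsub>hunits F\<^esub> (int i)" using pow[of i] by (simp add: int_pow_int)
    thus "x \<in> range (\<lambda>n::int. Some (1 mod r) [^]\<^bsub>hunits F\<^esub> n)" by blast
  qed
  thus "cyclic_group (hunits F)"
    unfolding cyclic_group using g int_pow_closed by blast
qed

lemma stable_hyperfield_aux:
  fixes F :: "(nat option, 'b) hyperstructure_scheme" and s :: nat
  assumes r: "0 < r" and s: "(s + s) mod r = 0"
    and F: "carrier F = cyc_carrier r" "monoid.mult F = cyc_mult r" "\<one>\<^bsub>F\<^esub> = Some 0" "hzero F = None"
    and add: "\<And>b. None \<boxplus>\<^bsub>F\<^esub> b = {b}" "\<And>a. a \<boxplus>\<^bsub>F\<^esub> None = {a}"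
      "\<And>i j. \<lbrakk>i < r; j < r\<rbrakk> \<Longrightarrow> Some i \<boxplus>\<^bsub>F\<^esub> Some j =
        (if j = (s + i) mod r then cyc_carrier r else cyc_carrier r - {None})"
  shows "hyperfield F"
proof -
  have car: "x \<in> carrier F \<longleftrightarrow> x = None \<or> (\<exists>i<r. x = Some i)" for x
    by (auto simp: F cyc_carrier_def)
  have car': "cyc_carrier r = carrier F" by (simp add: F)
  define n where "n i = (s + i) mod r" for i
  have n: "n i < r" for i using r by (simp add: n_def)
  have nn: "n (n i) = i" if "i < r" for i
  proof -
    have "n (n i) = (i + (s + s) mod r) mod r" by (simp add: n_def mod_simps ac_simps)
    thus ?thesis using s that by simp
  qed
  have add': "Some i \<boxplus>\<^bsub>F\<^esub> Some j = (if j = n i then carrier F else carrier F - {None})"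
    if "i < r" "j < r" for i j
    using add(3)[OF that] by (simp add: F n_def)
  have swap: "j = n i \<longleftrightarrow> i = n j" if "i < r" "j < r" for i j using nn that by metis
  have sup: "carrier F - {None} \<subseteq> Some i \<boxplus>\<^bsub>F\<^esub> Some j" if "i < r" "j < r" for i j
    using add'[OF that] by auto
  have comm: "x \<boxplus>\<^bsub>F\<^esub> y = y \<boxplus>\<^bsub>F\<^esub> x" if "x \<in> carrier F" "y \<in> carrier F" for x y
    using that swap by (auto simp: car add(1,2) add')
  have closed: "x \<boxplus>\<^bsub>F\<^esub> y \<subseteq> carrier F" if "x \<in> carrier F" "y \<in> carrier F" for x y
    using that by (auto simp: car add(1,2) add' split: if_splits)
  have nonempty: "x \<boxplus>\<^bsub>F\<^esub> y \<noteq> {}" if ps: "x \<in> carrier F" "y \<in> carrier F" for x y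
  proof -
    have "Some 0 \<in> carrier F - {None}" using r by (simp add: car)
    show ?thesis
    proof (cases "x = None \<or> y = None")
      case True thus ?thesis by (auto simp: add(1,2))
    next
      case False
      then obtain i j where "x = Some i" "y = Some j" "i < r" "j < r" using ps by (auto simp: car)
      thus ?thesis using sup[of i j] \<open>Some 0 \<in> carrier F - {None}\<close> by blast
    qed
  qed
  have neg: "None \<in> Some i \<boxplus>\<^bsub>F\<^esub> y \<and> y \<in> carrier F \<longleftrightarrow> y = Some (n i)" if "i < r" for i y
    using that n[of i] by (cases y) (auto simp: car add(1,2) add' split: if_splits)
  have neg0: "None \<in> None \<boxplus>\<^bsub>F\<^esub> y \<and> y \<in> carrier F \<longleftrightarrow> y = None" for y
    by (auto simp: car add(1))
  have hneg: "hneg F (Some i) = Some (n i)" if "i < r" for i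
    unfolding hneg_def F(4) using neg[OF that] by (intro the_equality) blast+
  have hneg0: "hneg F None = None"
    unfolding hneg_def F(4) using neg0 by (intro the_equality) blast+
  have assoc: "hadd_set F (x \<boxplus>\<^bsub>F\<^esub> y) z = (\<Union>w \<in> y \<boxplus>\<^bsub>F\<^esub> z. x \<boxplus>\<^bsub>F\<^esub> w)"
    if xyz: "x \<in> carrier F" "y \<in> carrier F" "z \<in> carrier F" for x y z
  proof (cases "x = None \<or> y = None \<or> z = None")
    case True thus ?thesis by (auto simp: hadd_set_def add(1,2))
  next
    case False
    then obtain i j k where ijk: "x = Some i" "y = Some j" "z = Some k" "i < r" "j < r" "k < r"
      using xyz by (auto simp: car)
    have "hadd_set F (x \<boxplus>\<^bsub>F\<^esub> y) z \<subseteq> carrier F"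
      unfolding hadd_set_def using closed xyz by blast
    moreover have "carrier F \<subseteq> hadd_set F (x \<boxplus>\<^bsub>F\<^esub> y) z"
    proof -
      have "Some (n k) \<in> x \<boxplus>\<^bsub>F\<^esub> y" using sup[OF ijk(4,5)] ijk n by (auto simp: car)
      moreover have "Some (n k) \<boxplus>\<^bsub>F\<^esub> z = carrier F" using ijk n nn add' by simp
      ultimately show ?thesis unfolding hadd_set_def by blast
    qed
    moreover have "(\<Union>w \<in> y \<boxplus>\<^bsub>F\<^esub> z. x \<boxplus>\<^bsub>F\<^esub> w) \<subseteq> carrier F" using closed xyz by blast
    moreover have "carrier F \<subseteq> (\<Union>w \<in> y \<boxplus>\<^bsub>F\<^esub> z. x \<boxplus>\<^bsub>F\<^esub> w)"
    proof -
      have "Some (n i) \<in> y \<boxplus>\<^bsub>F\<^esub> z" using sup[OF ijk(5,6)] ijk n by (auto simp: car)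
      moreover have "x \<boxplus>\<^bsub>F\<^esub> Some (n i) = carrier F" using ijk n add' by simp
      ultimately show ?thesis by blast
    qed
    ultimately show ?thesis by blast
  qed
  have rev: "y \<in> z \<boxplus>\<^bsub>F\<^esub> hneg F x"
    if xyz: "x \<in> carrier F" "y \<in> carrier F" "z \<in> x \<boxplus>\<^bsub>F\<^esub> y" for x y z
  proof (cases x)
    case None thus ?thesis using xyz by (simp add: hneg0 add(1,2))
  next
    case (Some i)
    hence i: "i < r" using xyz by (auto simp: car)
    have zc: "z \<in> carrier F" using closed xyz by blast
    show ?thesis
    proof (cases y)
      case None
      hence "z = Some i" using xyz Some by (simp add: add)
      thus ?thesis using None neg[OF i, of "Some (n i)"] Some hneg[OF i] by simp
    next
      case y: (Some j)
      hence j: "j < r" using xyz by (auto simp: car)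
      show ?thesis
      proof (cases z)
        case None
        hence "y = Some (n i)" using neg[OF i, of y] xyz Some None by blast
        thus ?thesis using None Some hneg[OF i] by (simp add: add)
      next
        case z: (Some k)
        hence k: "k < r" using zc by (auto simp: car)
        have "y \<in> carrier F - {None}" using y xyz by simp
        thus ?thesis unfolding z Some hneg[OF i] using sup[OF k n[of i]] by blast
      qed
    qed
  qed
  have units: "comm_group (hunits F)" using cyc_units(1)[OF r F] .
  have mcomm: "x \<otimes>\<^bsub>F\<^esub> y = y \<otimes>\<^bsub>F\<^esub> x" for x y
    by (cases x; cases y) (simp_all add: F add.commute)
  have dist: "(\<lambda>w. x \<otimes>\<^bsub>F\<^esub> w) ` (y \<boxplus>\<^bsub>F\<^esub> z) = (x \<otimes>\<^bsub>F\<^esub> y) \<boxplus>\<^bsub>F\<^esub> (x \<otimes>\<^bsub>F\<^esub> z)"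
    if xyz: "x \<in> carrier F" "y \<in> carrier F" "z \<in> carrier F" for x y z
  proof (cases x)
    case None
    have m: "None \<otimes>\<^bsub>F\<^esub> w = None" for w by (simp add: F)
    show ?thesis unfolding None m using nonempty[OF xyz(2,3)] by (auto simp: add(1))
  next
    case (Some i)
    hence i: "i < r" using xyz by (auto simp: car)
    have mN: "x \<otimes>\<^bsub>F\<^esub> None = None" by (simp add: F)
    have mS: "x \<otimes>\<^bsub>F\<^esub> Some j = Some ((i + j) mod r)" for j by (simp add: F Some)
    have inj: "(i + a) mod r = (i + b) mod r \<longleftrightarrow> a = b" if "a < r" "b < r" for a b
      using that cong_add_lcancel_nat[of i a b r] cong_less_modulus_unique_nat[of a b r]
      by (auto simp: cong_def)
    have surj: "\<exists>a<r. (i + a) mod r = b" if "b < r" for b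
      by (rule exI[of _ "(b + (r - i)) mod r"]) (use that i r in \<open>simp add: mod_simps\<close>)
    have im: "(\<lambda>w. x \<otimes>\<^bsub>F\<^esub> w) ` (carrier F - {None}) = carrier F - {None}"
    proof (intro Set.set_eqI iffI)
      fix w assume "w \<in> carrier F - {None}"
      then obtain b where "b < r" "w = Some b" by (auto simp: car)
      then obtain a where "a < r" "w = x \<otimes>\<^bsub>F\<^esub> Some a" using surj mS by metis
      thus "w \<in> (\<lambda>w. x \<otimes>\<^bsub>F\<^esub> w) ` (carrier F - {None})" by (auto simp: car)
    qed (use r in \<open>auto simp: car mS\<close>)
    have "carrier F = insert None (carrier F - {None})" by (auto simp: car)
    hence im': "(\<lambda>w. x \<otimes>\<^bsub>F\<^esub> w) ` carrier F = carrier F"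
      using im mN by (metis image_insert)
    show ?thesis
    proof (cases "y = None \<or> z = None")
      case True thus ?thesis using mN by (auto simp: add(1,2))
    next
      case False
      then obtain j k where jk: "y = Some j" "z = Some k" "j < r" "k < r"
        using xyz by (auto simp: car)
      have "n ((i + j) mod r) = (i + n j) mod r" by (simp add: n_def mod_simps ac_simps)
      hence "(i + k) mod r = n ((i + j) mod r) \<longleftrightarrow> k = n j" using inj n jk by simp
      thus ?thesis using jk r im im' by (simp add: mS add')
    qed
  qed
  show ?thesis
  proof (intro hyperfield.intro canonical_hypergroup.intro hyperfield_axioms.intro)
    show "\<exists>!y. y \<in> carrier F \<and> hzero F \<in> x \<boxplus>\<^bsub>F\<^esub> y" if "x \<in> carrier F" for x
      unfolding F(4)
    proof (cases x)
      case None thus "\<exists>!y. y \<in> carrier F \<and> None \<in> x \<boxplus>\<^bsub>F\<^esub> y" using neg0 by metis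
    next
      case (Some i)
      hence "i < r" using that by (auto simp: car)
      thus "\<exists>!y. y \<in> carrier F \<and> None \<in> x \<boxplus>\<^bsub>F\<^esub> y" using neg Some by metis
    qed
    show "(\<lambda>w. w \<otimes>\<^bsub>F\<^esub> x) ` (y \<boxplus>\<^bsub>F\<^esub> z) = (y \<otimes>\<^bsub>F\<^esub> x) \<boxplus>\<^bsub>F\<^esub> (z \<otimes>\<^bsub>F\<^esub> x)"
      if "x \<in> carrier F" "y \<in> carrier F" "z \<in> carrier F" for x y z
      using dist[OF that] by (simp add: mcomm[of _ x])
    show "hzero F \<in> carrier F" by (simp add: F(4) car)
    show "x \<boxplus>\<^bsub>F\<^esub> hzero F = {x}" for x by (simp add: F(4) add)
    show "hzero F \<otimes>\<^bsub>F\<^esub> x = hzero F" "x \<otimes>\<^bsub>F\<^esub> hzero F = hzero F" for x by (simp_all add: F(2,4))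
  qed (fact comm closed nonempty assoc rev units dist)+
qed

lemma stable_H_hyperfield:
  assumes "r \<ge> 2"
  shows "hyperfield (stable_H r)" "order (hunits (stable_H r)) = r"
    "cyclic_group (hunits (stable_H r))"
proof -
  show "hyperfield (stable_H r)"
  proof (rule stable_hyperfield_aux[of r 0])
    show "a \<boxplus>\<^bsub>stable_H r\<^esub> None = {a}" for a by (cases a) (simp_all add: stable_H_def)
  qed (use assms in \<open>auto simp: stable_H_def\<close>)
  show "order (hunits (stable_H r)) = r"
    by (rule cyc_units(2)) (use assms in \<open>simp_all add: stable_H_def\<close>)
  show "cyclic_group (hunits (stable_H r))"
    by (rule cyc_units(3)[of r]) (use assms in \<open>simp_all add: stable_H_def\<close>)
qed

lemma stable_H'_hyperfield:
  assumes "r \<ge> 2" "even r"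
  shows "hyperfield (stable_H' r)" "order (hunits (stable_H' r)) = r"
    "cyclic_group (hunits (stable_H' r))"
proof -
  show "hyperfield (stable_H' r)"
  proof (rule stable_hyperfield_aux[of r "r div 2"])
    show "a \<boxplus>\<^bsub>stable_H' r\<^esub> None = {a}" for a by (cases a) (simp_all add: stable_H'_def)
    have "r div 2 + r div 2 = r" using assms(2) by auto
    thus "(r div 2 + r div 2) mod r = 0" by simp
  qed (use assms in \<open>auto simp: stable_H'_def\<close>)
  show "order (hunits (stable_H' r)) = r"
    by (rule cyc_units(2)) (use assms in \<open>simp_all add: stable_H'_def\<close>)
  show "cyclic_group (hunits (stable_H' r))"
    by (rule cyc_units(3)[of r]) (use assms in \<open>simp_all add: stable_H'_def\<close>)
qed

end

theory Submission
  imports Defs "HOL-Algebra.Weak_Morphisms"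
begin

text \<open>
  The two characteristics of a hyperfield are read off from the sets \<open>n \<times> 1\<close>, which are built
  from \<open>1\<close> and hyperaddition alone; an isomorphism therefore carries them onto each other, and
  isomorphic hyperfields have the same characteristics (\<open>hchar_iso\<close>, \<open>C_char_iso\<close>). Above a
  Baker--Jin threshold \<open>K\<close> is isomorphic to \<open>\<H>\<^sub>r\<close> or \<open>\<H>\<^sub>r'\<close>, so it suffices to compute there.
  In both models \<open>1 \<boxplus> 1\<close> contains every nonzero element, in particular \<open>1\<close>, whence the
  C-characteristic is 1. In \<open>\<H>\<^sub>r\<close> moreover \<open>-1 = 1\<close>, so \<open>0 \<in> 1 \<boxplus> 1\<close> and the characteristic is
  2. In \<open>\<H>\<^sub>r'\<close> the element \<open>-1\<close> is the element of order 2, which differs from \<open>1\<close>: hence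
  \<open>0 \<notin> 1 \<boxplus> 1\<close>, but \<open>-1 \<in> 1 \<boxplus> 1\<close> gives \<open>0 \<in> 3 \<times> 1\<close>, and the characteristic is 3.

  One point is not visible in this argument. The threshold speaks about fields whose elements are
  natural numbers, while the field of the theorem lives in an arbitrary type. A finite field can
  be copied onto a set of natural numbers, and the copy has an isomorphic Krasner quotient
  (\<open>krasner_quotient_iso\<close>) by the matching subgroup (\<open>index_subgroup_image\<close>), so once more
  invariance under isomorphism applies.
\<close>

section \<open>Invariance of the characteristics under isomorphism\<close>

lemma (in hyperfield) one_closed: "\<one> \<in> carrier F"
proof -
  interpret U: comm_group "hunits F" by (rule hunits_group)
  show ?thesis using U.one_closed by (simp add: hunits_def)
qed

text \<open>An isomorphism is only required to respect hypersums of elements of the carrier, so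
  comparing the multiples of \<open>1\<close> needs to know that they stay there.\<close>

lemma (in hyperfield) hmultiple_closed: "hmultiple F n \<subseteq> carrier F"
proof (induction n)
  case (Suc n)
  thus ?case
    by (cases n) (use one_closed hadd_closed in \<open>auto simp: hadd_set_def\<close>)
qed (simp add: hzero_closed)

lemma (in hyperfield) hmultiple_iso:
  assumes "hyperfield_iso F K f"
  shows "hmultiple K n = f ` hmultiple F n"
proof (induction n)
  case (Suc n)
  show ?case
  proof (cases n)
    case 0
    thus ?thesis using assms by (simp add: hyperfield_iso_def)
  next
    case (Suc m)
    have "f ` (a \<boxplus> \<one>) = f a \<boxplus>\<^bsub>K\<^esub> \<one>\<^bsub>K\<^esub>" if "a \<in> hmultiple F n" for a
      using assms that hmultiple_closed one_closed unfolding hyperfield_iso_def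
      by (metis subsetD)
    thus ?thesis using Suc.IH by (simp add: Suc hadd_set_def image_UN)
  qed
qed (use assms in \<open>simp add: hyperfield_iso_def\<close>)

lemma (in hyperfield) iso_mem_hmultiple_iff:
  assumes "hyperfield_iso F K f" "x \<in> carrier F"
  shows "f x \<in> hmultiple K n \<longleftrightarrow> x \<in> hmultiple F n"
proof -
  have "inj_on f (carrier F)" using assms(1) by (simp add: hyperfield_iso_def bij_betw_def)
  thus ?thesis
    unfolding hmultiple_iso[OF assms(1)]
    using assms(2) hmultiple_closed by (rule inj_on_image_mem_iff)
qed

lemma (in hyperfield) hchar_iso:
  assumes "F \<cong>\<^sub>h K"
  shows "hchar K = hchar F"
proof -
  obtain f where f: "hyperfield_iso F K f" using assms by (auto simp: hyperfield_isomorphic_def)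
  have "hzero K \<in> hmultiple K n \<longleftrightarrow> hzero F \<in> hmultiple F n" for n
    using iso_mem_hmultiple_iff[OF f hzero_closed] f by (simp add: hyperfield_iso_def)
  thus ?thesis by (simp add: hchar_def)
qed

lemma (in hyperfield) C_char_iso:
  assumes "F \<cong>\<^sub>h K"
  shows "C_char K = C_char F"
proof -
  obtain f where f: "hyperfield_iso F K f" using assms by (auto simp: hyperfield_isomorphic_def)
  have "\<one>\<^bsub>K\<^esub> \<in> hmultiple K n \<longleftrightarrow> \<one> \<in> hmultiple F n" for n
    using iso_mem_hmultiple_iff[OF f one_closed] f by (simp add: hyperfield_iso_def)
  thus ?thesis by (simp add: C_char_def)
qed

section \<open>The characteristics of the stable models\<close>

lemma hchar_eqI:
  assumes "n \<ge> 1" "hzero F \<in> hmultiple F n"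
    and "\<And>m. \<lbrakk>1 \<le> m; m < n\<rbrakk> \<Longrightarrow> hzero F \<notin> hmultiple F m"
  shows "hchar F = enat n"
proof -
  have "(LEAST n. n \<ge> 1 \<and> hzero F \<in> hmultiple F n) = n"
    using assms by (intro Least_equality) (auto simp: not_less[symmetric])
  thus ?thesis using assms by (auto simp: hchar_def)
qed

lemma C_char_eq_1:
  assumes "\<one>\<^bsub>F\<^esub> \<in> hmultiple F 2"
  shows "C_char F = 1"
proof -
  have "(LEAST n. n \<ge> 1 \<and> \<one>\<^bsub>F\<^esub> \<in> hmultiple F (n + 1)) = 1"
    using assms by (intro Least_equality) (auto simp: numeral_2_eq_2)
  thus ?thesis using assms by (auto simp: C_char_def one_enat_def numeral_2_eq_2)
qed

lemma hmultiple_2: "hmultiple F 2 = \<one>\<^bsub>F\<^esub> \<boxplus>\<^bsub>F\<^esub> \<one>\<^bsub>F\<^esub>"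
  by (simp add: numeral_2_eq_2 hadd_set_def)

lemma hmultiple_3: "hmultiple F 3 = hadd_set F (hmultiple F 2) \<one>\<^bsub>F\<^esub>"
  by (simp add: numeral_3_eq_3 numeral_2_eq_2)

lemma stable_H_char:
  assumes "r > 0"
  shows "hchar (stable_H r) = 2" "C_char (stable_H r) = 1"
proof -
  have two: "hmultiple (stable_H r) 2 = cyc_carrier r"
    by (simp add: hmultiple_2 stable_H_def)
  have "hchar (stable_H r) = enat 2"
  proof (rule hchar_eqI)
    show "hzero (stable_H r) \<in> hmultiple (stable_H r) 2"
      unfolding two by (simp add: stable_H_def cyc_carrier_def)
    fix m :: nat assume "1 \<le> m" "m < 2"
    hence "m = 1" by simp
    thus "hzero (stable_H r) \<notin> hmultiple (stable_H r) m"
      by (simp add: stable_H_def)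
  qed simp
  thus "hchar (stable_H r) = 2" by (simp add: numeral_eq_enat)
  show "C_char (stable_H r) = 1"
    using assms by (intro C_char_eq_1, unfold two) (simp add: stable_H_def cyc_carrier_def)
qed

lemma stable_H'_char:
  assumes "r \<ge> 2" "even r"
  shows "hchar (stable_H' r) = 3" "C_char (stable_H' r) = 1"
proof -
  have half: "0 < r div 2" "r div 2 < r" "r div 2 + r div 2 = r" using assms by auto
  \<comment> \<open>Here \<open>-1 = g ^ (r div 2)\<close> differs from \<open>1 = g ^ 0\<close>.\<close>
  have two: "hmultiple (stable_H' r) 2 = cyc_carrier r - {None}"
    using half by (simp add: hmultiple_2 stable_H'_def)
  have "hchar (stable_H' r) = enat 3"
  proof (rule hchar_eqI)
    \<comment> \<open>The element \<open>-1\<close> of \<open>1 \<boxplus> 1\<close> contributes \<open>-1 \<boxplus> 1\<close>, which contains \<open>0\<close>.\<close>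
    have "Some (r div 2) \<in> hmultiple (stable_H' r) 2"
      unfolding two using half by (simp add: cyc_carrier_def)
    moreover have "None \<in> stable_hadd' r (Some (r div 2)) (Some 0)"
      using half by (simp add: cyc_carrier_def)
    ultimately show "hzero (stable_H' r) \<in> hmultiple (stable_H' r) 3"
      unfolding hmultiple_3 hadd_set_def
      by (intro UN_I) (auto simp: stable_H'_def)
    fix m :: nat assume "1 \<le> m" "m < 3"
    then consider "m = 1" | "m = 2" by linarith
    thus "hzero (stable_H' r) \<notin> hmultiple (stable_H' r) m"
    proof cases
      case 2
      show ?thesis unfolding 2 two by (simp add: stable_H'_def)
    qed (simp add: stable_H'_def)
  qed simp
  thus "hchar (stable_H' r) = 3" by (simp add: numeral_eq_enat)
  show "C_char (stable_H' r) = 1"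
    using assms by (intro C_char_eq_1, unfold two) (simp add: stable_H'_def cyc_carrier_def)
qed

section \<open>Krasner quotients of isomorphic fields\<close>

lemma ring_iso_group_hom_mult_of:
  assumes R: "field R" and S: "field S" and h: "h \<in> ring_iso R S"
  shows "group_hom (mult_of R) (mult_of S) h"
proof -
  interpret R: field R by fact
  interpret S: field S by fact
  interpret ring_hom_ring R S h
    using h R.ring_axioms S.ring_axioms by (intro ring_hom_ringI2) (auto simp: ring_iso_def)
  have inj: "inj_on h (carrier R)" using h by (simp add: ring_iso_def bij_betw_def)
  have "h x \<noteq> \<zero>\<^bsub>S\<^esub>" if "x \<in> carrier R" "x \<noteq> \<zero>\<^bsub>R\<^esub>" for x
    using inj_onD[OF inj, of x "\<zero>\<^bsub>R\<^esub>"] that by auto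
  thus ?thesis
    using R.field_mult_group S.field_mult_group
    by (auto simp: group_hom_def group_hom_axioms_def hom_def)
qed

text \<open>The image of the subgroup of index \<open>r\<close> is again a subgroup, and by Lagrange its index is
  determined by its order; uniqueness of the subgroup of index \<open>r\<close> does the rest.\<close>

lemma index_subgroup_image:
  fixes R :: "('a, 'c) ring_scheme" and S :: "('b, 'd) ring_scheme"
  assumes R: "field R" and S: "field S" and fin: "finite (carrier R)"
    and r: "r dvd order R - 1" and h: "h \<in> ring_iso R S"
  shows "index_subgroup S r = h ` index_subgroup R r"
proof -
  interpret MR: group "mult_of R" using R by (rule field.field_mult_group)
  interpret MS: group "mult_of S" using S by (rule field.field_mult_group)
  interpret M: group_hom "mult_of R" "mult_of S" h
    using ring_iso_group_hom_mult_of[OF R S h] .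
  have bij: "bij_betw h (carrier R) (carrier S)" using h by (simp add: ring_iso_def)
  have finS: "finite (carrier S)" using bij fin bij_betw_finite by blast
  have ord: "order S = order R" using bij bij_betw_same_card by (fastforce simp: order_def)
  define G where "G = index_subgroup R r"
  have G: "subgroup G (mult_of R)" "card (rcosets\<^bsub>mult_of R\<^esub> G) = r"
    using theI'[OF index_subgroup_ex1[OF R fin r]] by (simp_all add: G_def index_subgroup_def)
  have GR: "G \<subseteq> carrier R" using subgroup.subset[OF G(1)] by auto
  have hG: "subgroup (h ` G) (mult_of S)" using G(1) by (rule M.subgroup_img_is_subgroup)
  have "inj_on h G" using bij GR inj_on_subset by (auto simp: bij_betw_def)
  hence card: "card (h ` G) = card G" by (rule card_image)
  have "G \<noteq> {}" using subgroup.one_closed[OF G(1)] by blast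
  hence pos: "card G > 0" using finite_subset[OF GR fin] by (simp add: card_gt_0_iff)
  have "card (rcosets\<^bsub>mult_of S\<^esub> (h ` G)) * card G = r * card G"
    using MR.lagrange_finite[OF _ G(1)] MS.lagrange_finite[OF _ hG] fin finS
    by (simp add: field.order_mult_of[OF R] field.order_mult_of[OF S] ord card G(2))
  hence idx: "card (rcosets\<^bsub>mult_of S\<^esub> (h ` G)) = r" using pos by simp
  have "\<exists>!H. subgroup H (mult_of S) \<and> card (rcosets\<^bsub>mult_of S\<^esub> H) = r"
    using index_subgroup_ex1[OF S finS] r ord by simp
  hence "index_subgroup S r = h ` G"
    unfolding index_subgroup_def using conjI[OF hG idx] by (rule the1_equality)
  thus ?thesis by (simp only: G_def)
qed

text \<open>An isomorphism \<open>h\<close> of fields sends the class \<open>x G\<close> to the class \<open>h(x) h(G)\<close>, so taking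
  images under \<open>h\<close> is the isomorphism of the quotients.\<close>

lemma krasner_quotient_iso:
  fixes R :: "('a, 'c) ring_scheme" and S :: "('b, 'd) ring_scheme"
  assumes R: "field R" and S: "field S" and G: "subgroup G (mult_of R)"
    and h: "h \<in> ring_iso R S"
  shows "krasner_quotient R G \<cong>\<^sub>h krasner_quotient S (h ` G)"
proof -
  interpret R: field R by fact
  interpret S: field S by fact
  interpret ring_hom_ring R S h
    using h R.ring_axioms S.ring_axioms by (intro ring_hom_ringI2) (auto simp: ring_iso_def)
  let ?K = "krasner_quotient R G" and ?L = "krasner_quotient S (h ` G)"
  have inj: "inj_on h (carrier R)" and surj: "h ` carrier R = carrier S"
    using h by (simp_all add: ring_iso_def bij_betw_def)
  have hG: "subgroup (h ` G) (mult_of S)"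
    using G ring_iso_group_hom_mult_of[OF R S h] group_hom.subgroup_img_is_subgroup by blast
  have GR: "g \<in> carrier R" if "g \<in> G" for g using subgroup.subset[OF G] that by auto
  have car: "carrier ?K = (\<lambda>x. x <#\<^bsub>R\<^esub> G) ` carrier R"
    "carrier ?L = (\<lambda>x. x <#\<^bsub>S\<^esub> h ` G) ` carrier S"
    by (auto simp: krasner_quotient_def)
  have cls: "h ` (x <#\<^bsub>R\<^esub> G) = h x <#\<^bsub>S\<^esub> h ` G" if "x \<in> carrier R" for x
    using that GR by (auto simp: l_coset_def image_UN)
  have sub: "x <#\<^bsub>R\<^esub> G \<subseteq> carrier R" if "x \<in> carrier R" for x
    using that GR by (auto simp: l_coset_def)
  have "inj_on ((`) h) (carrier ?K)"
    using inj_on_image_eq_iff[OF inj] sub by (auto simp: inj_on_def car)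
  moreover have "(`) h ` carrier ?K = carrier ?L"
    unfolding car surj[symmetric] image_image by (rule image_cong) (auto simp: cls)
  moreover have "h ` (A \<otimes>\<^bsub>?K\<^esub> B) = h ` A \<otimes>\<^bsub>?L\<^esub> h ` B"
    if AB: "A \<in> carrier ?K" "B \<in> carrier ?K" for A B
  proof -
    obtain x y where xy: "x \<in> carrier R" "y \<in> carrier R" "A = x <#\<^bsub>R\<^esub> G" "B = y <#\<^bsub>R\<^esub> G"
      using AB by (auto simp: car)
    thus ?thesis by (simp add: cls krasner_mult[OF R G] krasner_mult[OF S hG])
  qed
  moreover have "(`) h ` (A \<boxplus>\<^bsub>?K\<^esub> B) = h ` A \<boxplus>\<^bsub>?L\<^esub> h ` B"
    if AB: "A \<in> carrier ?K" "B \<in> carrier ?K" for A B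
  proof -
    obtain x y where xy: "x \<in> carrier R" "y \<in> carrier R" "A = x <#\<^bsub>R\<^esub> G" "B = y <#\<^bsub>R\<^esub> G"
      using AB by (auto simp: car)
    have "(`) h ` (A \<boxplus>\<^bsub>?K\<^esub> B) = (\<lambda>g. h ` ((x \<oplus>\<^bsub>R\<^esub> y \<otimes>\<^bsub>R\<^esub> g) <#\<^bsub>R\<^esub> G)) ` G"
      using xy by (auto simp: krasner_hadd[OF R G])
    also have "\<dots> = (\<lambda>g. (h x \<oplus>\<^bsub>S\<^esub> h y \<otimes>\<^bsub>S\<^esub> h g) <#\<^bsub>S\<^esub> h ` G) ` G"
      using xy GR by (intro image_cong refl) (simp add: cls)
    also have "\<dots> = h ` A \<boxplus>\<^bsub>?L\<^esub> h ` B"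
      using xy by (auto simp: cls krasner_hadd[OF S hG])
    finally show ?thesis .
  qed
  ultimately have "hyperfield_iso ?K ?L ((`) h)"
    using cls[OF R.zero_closed] cls[OF R.one_closed]
    by (simp add: hyperfield_iso_def bij_betw_def) (simp add: krasner_quotient_def)
  thus ?thesis by (auto simp: hyperfield_isomorphic_def)
qed

lemma finite_field_nat_copy:
  fixes R :: "('a, 'b) ring_scheme"
  assumes "field R" "finite (carrier R)"
  shows "\<exists>(S :: nat ring) h. field S \<and> h \<in> ring_iso R S"
proof -
  obtain h :: "'a \<Rightarrow> nat" where h: "inj_on h (carrier R)"
    using finite_imp_inj_to_nat_seg[OF assms(2)] by blast
  show ?thesis
    using field.inj_imp_image_ring_is_field[OF assms(1) h]
      inj_imp_image_ring_iso[OF h] by blast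
qed

section \<open>The characteristics of large Krasner quotients\<close>

theorem theorem3p1:
  fixes r :: nat
  assumes "r \<ge> 2"
  shows "(\<forall>N q. \<forall>R :: ('a, 'b) ring_scheme.
            baker_jin_threshold r N \<and> primepow q \<and> r dvd (q - 1) \<and> q \<ge> N \<and>
            field R \<and> order R = q \<longrightarrow>
              (let K = krasner_quotient R (index_subgroup R r) in
                (odd r \<longrightarrow> (hchar K, C_char K) = (2, 1)) \<and>
                (even r \<and> [q = 1] (mod (2 * r)) \<longrightarrow> (hchar K, C_char K) = (2, 1)) \<and>
                (even r \<and> [q = r + 1] (mod (2 * r)) \<longrightarrow> (hchar K, C_char K) = (3, 1)))) \<and>
         (even r \<longrightarrow> hchar (stable_H r) \<noteq> hchar (stable_H' r))"
proof (intro conjI allI impI)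
  assume "even r"
  have "(2 :: enat) \<noteq> 3" by simp
  thus "hchar (stable_H r) \<noteq> hchar (stable_H' r)"
    using stable_H_char(1)[of r] stable_H'_char(1)[OF assms \<open>even r\<close>] assms by simp
next
  fix N q :: nat and R :: "('a, 'b) ring_scheme"
  assume *: "baker_jin_threshold r N \<and> primepow q \<and> r dvd (q - 1) \<and> q \<ge> N \<and>
    field R \<and> order R = q"
  hence R: "field R" and r: "r dvd order R - 1" by auto
  have "order R > 0" using * by (auto intro: primepow_gt_0_nat)
  hence fin: "finite (carrier R)" by (simp add: order_def card_gt_0_iff)
  define K where "K = krasner_quotient R (index_subgroup R r)"
  obtain S :: "nat ring" and h where S: "field S" and h: "h \<in> ring_iso R S"
    using finite_field_nat_copy[OF R fin] by blast
  define L where "L = krasner_quotient S (index_subgroup S r)"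
  have ord: "order S = order R"
    using h bij_betw_same_card by (fastforce simp: order_def ring_iso_def)
  have finS: "finite (carrier S)" using \<open>order R > 0\<close> ord by (simp add: order_def card_ge_0_finite)
  have G: "subgroup (index_subgroup R r) (mult_of R)"
    using theI'[OF index_subgroup_ex1[OF R fin r]] by (simp add: index_subgroup_def)
  have GS: "subgroup (index_subgroup S r) (mult_of S)"
    using theI'[OF index_subgroup_ex1[OF S finS]] r ord by (simp add: index_subgroup_def)
  have "K \<cong>\<^sub>h L"
    unfolding K_def L_def index_subgroup_image[OF R S fin r h]
    by (rule krasner_quotient_iso[OF R S G h])
  moreover have "hyperfield K"
    unfolding K_def by (rule krasner_quotient_hyperfield[OF R G])
  ultimately have KL: "hchar K = hchar L" "C_char K = C_char L"
    by (simp_all add: hyperfield.hchar_iso hyperfield.C_char_iso)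
  have L: "hyperfield L"
    unfolding L_def by (rule krasner_quotient_hyperfield[OF S GS])
  have via: "hchar K = hchar T" "C_char K = C_char T"
    if "L \<cong>\<^sub>h T" for T :: "nat option hyperstructure"
    using KL hyperfield.hchar_iso[OF L that] hyperfield.C_char_iso[OF L that] by simp_all
  have stable: "(odd r \<longrightarrow> L \<cong>\<^sub>h stable_H r) \<and>
      (even r \<longrightarrow> ([q = 1] (mod (2 * r)) \<longrightarrow> L \<cong>\<^sub>h stable_H r) \<and>
        ([q = r + 1] (mod (2 * r)) \<longrightarrow> L \<cong>\<^sub>h stable_H' r))"
    using * S ord unfolding baker_jin_threshold_def L_def by blast
  have H: "(hchar K, C_char K) = (2, 1)" if "L \<cong>\<^sub>h stable_H r"
    using via[OF that] stable_H_char[of r] assms by simp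
  have H': "(hchar K, C_char K) = (3, 1)" if "even r" "L \<cong>\<^sub>h stable_H' r"
    using via[OF that(2)] stable_H'_char[OF assms that(1)] by simp
  show "let K = krasner_quotient R (index_subgroup R r) in
      (odd r \<longrightarrow> (hchar K, C_char K) = (2, 1)) \<and>
      (even r \<and> [q = 1] (mod (2 * r)) \<longrightarrow> (hchar K, C_char K) = (2, 1)) \<and>
      (even r \<and> [q = r + 1] (mod (2 * r)) \<longrightarrow> (hchar K, C_char K) = (3, 1))"
    unfolding Let_def K_def[symmetric]
    using stable H H' by blast
qed

end
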